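(* Let $G$ be a graph with $n$ vertices and let $x\in V(G)$ have degree $n-1$ (i.e. $x$ is adjacent to all other vertices). Let $H$ be the subgraph of $G$ induced by $V(G)\setminus\{x\}$. Then $G$ is a minimal non-word-representable graph if and only if $H$ is a minimal non-comparability graph and $H$ is semi-transitive.
   Context: All graphs are finite and simple. For a word $w$ and letters $i,j$, let $w_{ij}$ be the subsequence of $w$ consisting of all occurrences of $i$ and $j$; $i$ and $j$ alternate in $w$ if $w_{ij}$ contains no factor $ii$ or $jj$. A graph $G$ is word-representable if there is a word $w$ over $V(G)$ such that for all distinct $i,j\in V(G)$, $\{i,j\}\in E(G)$ if and only if $i$ and $j$ alternate in $w$. A graph is minimal non-word-representable if it is not word-representable but every proper induced subgraph is word-representable. A comparability graph is a graph admitting a transitive orientation (an orientation such that $u\to v$ and $v\to w$ imply $u\to w$); a minimal non-comparability graph is a graph that is not a comparability graph but all of whose proper induced subgraphs are comparability graphs. A graph is semi-transitive if it admits an acyclic orientation such that for every directed path $v_1\to v_2\to\cdots\to v_k$, either there is no edge $v_1\to v_k$, or for all $1\le i<j\le k$ there is an edge $v_i\to v_j$. *)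

theory Defs
  imports
    "Graph_Theory.Digraph_Component"
    "Graph_Theory.Vertex_Walk"
    "HOL-Library.Sublist"
begin

text \<open>
  A finite simple graph is a digraph \<open>G\<close> satisfying \<open>graph G\<close>: finite, loopless, without parallel
  arcs, and symmetric. The edge \<open>{u, v}\<close> is represented by the two arcs \<open>(u, v)\<close> and \<open>(v, u)\<close>, so
  adjacency is \<open>u \<rightarrow>\<^bsub>G\<^esub> v\<close> and the degree of a vertex is its \<open>out_degree\<close>.
\<close>

definition alternate :: "'a list \<Rightarrow> 'a \<Rightarrow> 'a \<Rightarrow> bool" where
  "alternate w i j \<longleftrightarrow>
     (let w' = filter (\<lambda>a. a = i \<or> a = j) w
      in \<not> sublist [i, i] w' \<and> \<not> sublist [j, j] w')"

text \<open>A word over \<open>verts G\<close> need not use every letter. Requiring this would not change the notion: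
  an absent letter alternates exactly with the letters occurring at most once, so it may be
  prepended once.\<close>
definition word_representable :: "('a, 'b) pre_digraph \<Rightarrow> bool" where
  "word_representable G \<longleftrightarrow>
     (\<exists>w. set w \<subseteq> verts G \<and>
       (\<forall>i \<in> verts G. \<forall>j \<in> verts G. i \<noteq> j \<longrightarrow> (i \<rightarrow>\<^bsub>G\<^esub> j \<longleftrightarrow> alternate w i j)))"

definition minimal_non_word_representable :: "('a, 'b) pre_digraph \<Rightarrow> bool" where
  "minimal_non_word_representable G \<longleftrightarrow>
     \<not> word_representable G \<and> (\<forall>S. S \<subset> verts G \<longrightarrow> word_representable (G \<restriction> S))"

definition orientation :: "('a, 'b) pre_digraph \<Rightarrow> ('a, 'b) pre_digraph \<Rightarrow> bool" where
  "orientation D G \<longleftrightarrow>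
     spanning D G \<and> (\<forall>u v. u \<rightarrow>\<^bsub>G\<^esub> v \<longrightarrow> (u \<rightarrow>\<^bsub>D\<^esub> v) \<noteq> (v \<rightarrow>\<^bsub>D\<^esub> u))"

definition comparability_graph :: "('a, 'b) pre_digraph \<Rightarrow> bool" where
  "comparability_graph G \<longleftrightarrow> (\<exists>D. orientation D G \<and> trans (arcs_ends D))"

definition minimal_non_comparability_graph :: "('a, 'b) pre_digraph \<Rightarrow> bool" where
  "minimal_non_comparability_graph G \<longleftrightarrow>
     \<not> comparability_graph G \<and> (\<forall>S. S \<subset> verts G \<longrightarrow> comparability_graph (G \<restriction> S))"

definition semi_transitive :: "('a, 'b) pre_digraph \<Rightarrow> bool" where
  "semi_transitive G \<longleftrightarrow>
     (\<exists>D. orientation D G \<and> acyclic (arcs_ends D) \<and>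
       (\<forall>p. vpath p D \<longrightarrow>
          \<not> (hd p \<rightarrow>\<^bsub>D\<^esub> last p) \<or>
          (\<forall>i j. i < j \<and> j < length p \<longrightarrow> p ! i \<rightarrow>\<^bsub>D\<^esub> p ! j)))"

end

theory Submission
  imports Defs
begin

text \<open>
  Letters \<open>u \<noteq> v\<close> alternate in a word iff, up to swapping them, every prefix \<open>p\<close> satisfies
  \<open>|p|\<^sub>v \<le> |p|\<^sub>u \<le> |p|\<^sub>v + 1\<close>; then \<open>u\<close> leads \<open>v\<close>. Orienting edges from the
  leading letter gives a semi-transitive orientation, because counts decrease along a directed path
  and an edge joining its ends bounds the total decrease by 1.

  Conversely, given a semi-transitive orientation and a non-adjacent pair \<open>(u, v)\<close>, there is a word
  using every letter twice in which tails lead heads but \<open>u\<close> does not lead \<open>v\<close>: if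
  \<open>v\<close> is reachable from \<open>u\<close>, both occurrences of \<open>u\<close> can be placed before those of \<open>v\<close>, since
  an obstruction would be an arc bypassing a path through \<open>u\<close> and \<open>v\<close>. Concatenating these
  words over all pairs represents the graph. Hence semi-transitive means word-representable.

  Finally, a graph with a vertex adjacent to all others is word-representable iff the rest is a
  comparability graph: make the vertex a source, or rotate the word to start with it and orient by
  leading. Both minimality conditions then compare the same induced subgraphs, except for \<open>H\<close>
  itself, where semi-transitivity is needed.
\<close>

section \<open>Alternation in terms of prefix counts\<close>

text \<open>For distinct letters, the restriction of \<open>w\<close> to \<open>u\<close> and
  \<open>v\<close> reads \<open>u v u v ...\<close>, starting with \<open>u\<close> or
  empty.\<close>

definition leads :: "'a list \<Rightarrow> 'a \<Rightarrow> 'a \<Rightarrow> bool" where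
  "leads w u v \<longleftrightarrow> (\<forall>p. prefix p w \<longrightarrow>
     count_list p v \<le> count_list p u \<and> count_list p u \<le> count_list p v + 1)"

lemma leadsD:
  assumes "leads w u v" "prefix p w"
  shows "count_list p v \<le> count_list p u" "count_list p u \<le> count_list p v + 1"
  using assms by (auto simp: leads_def)

lemma leads_Nil [simp]: "leads [] u v"
  by (simp add: leads_def)

text \<open>An initial \<open>u\<close> raises the difference of the two counts by 1, so the allowed
  range {0, 1} becomes {-1, 0} on the rest, which is \<open>leads\<close> with the roles
  exchanged.\<close>

lemma leads_Cons:
  assumes "u \<noteq> v"
  shows "leads (a # w) u v \<longleftrightarrow> (if a = u then leads w v u else a \<noteq> v \<and> leads w u v)"
proof -
  have *: "(\<forall>p. prefix p (a # w) \<longrightarrow> Q p) \<longleftrightarrow> Q [] \<and> (\<forall>p. prefix p w \<longrightarrow> Q (a # p))"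
    for Q :: "'a list \<Rightarrow> bool"
    by (auto simp: prefix_Cons)
  \<comment> \<open>This settles the case \<open>a = v\<close>: the shifted lower bound already
    fails at the empty prefix.\<close>
  have "\<not> (\<forall>p. prefix p w \<longrightarrow> count_list p v + 1 \<le> count_list p u \<and> Q p)" for Q
    by (auto intro!: exI[of _ "[]"])
  then show ?thesis
    using assms unfolding leads_def * by (auto simp: less_eq_Suc_le)
qed

lemma distinct_adj_iff_no_square: "distinct_adj xs \<longleftrightarrow> (\<forall>a. \<not> sublist [a, a] xs)"
proof (induction xs rule: induct_list012)
  case (3 x y zs)
  then show ?case by (auto simp: sublist_Cons_right prefix_Cons)
qed (auto simp: sublist_Cons_right)

lemma alternate_iff_distinct_adj:
  "alternate w i j \<longleftrightarrow> distinct_adj (filter (\<lambda>a. a = i \<or> a = j) w)"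
proof -
  have "a = i \<or> a = j" if "sublist [a, a] (filter (\<lambda>a. a = i \<or> a = j) w)" for a
    using set_mono_sublist[OF that] by auto
  then show ?thesis
    unfolding alternate_def distinct_adj_iff_no_square Let_def by blast
qed

text \<open>After \<open>u\<close> the next retained letter must be \<open>v\<close>, so the roles
  swap at each retained letter; hence the induction generalises both.\<close>

lemma distinct_adj_Cons_iff_leads:
  "u \<noteq> v \<Longrightarrow> distinct_adj (u # filter (\<lambda>a. a = u \<or> a = v) w) \<longleftrightarrow> leads w v u"
proof (induction w arbitrary: u v)
  case (Cons a w)
  have "filter (\<lambda>a. a = u \<or> a = v) w = filter (\<lambda>a. a = v \<or> a = u) w"
    by (simp add: disj_commute)
  with Cons.IH[of v u] Cons.IH[of u v] Cons.prems show ?case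
    by (auto simp: leads_Cons)
qed simp

lemma alternate_iff_leads:
  assumes "u \<noteq> v"
  shows "alternate w u v \<longleftrightarrow> leads w u v \<or> leads w v u"
proof (induction w)
  case (Cons a w)
  have "filter (\<lambda>a. a = u \<or> a = v) w = filter (\<lambda>a. a = v \<or> a = u) w"
    by (simp add: disj_commute)
  with Cons assms show ?case
    using distinct_adj_Cons_iff_leads[of u v w] distinct_adj_Cons_iff_leads[of v u w]
    by (auto simp: leads_Cons alternate_iff_distinct_adj)
qed (simp add: alternate_def)

text \<open>Both counts would agree in every prefix, which breaks at the first occurrence of
  \<open>u\<close>. Two absent letters, by contrast, do lead each other.\<close>

lemma leads_antisym:
  assumes "leads w u v" "leads w v u" "u \<in> set w"
  shows "u = v"
proof (rule ccontr)
  assume "u \<noteq> v"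
  from split_list_first[OF assms(3)] obtain ys zs where w: "w = ys @ u # zs" and "u \<notin> set ys"
    by blast
  have p: "prefix ys w" "prefix (ys @ [u]) w"
    using w by auto
  have "count_list ys u = count_list ys v" "count_list (ys @ [u]) u = count_list (ys @ [u]) v"
    using leadsD(1)[OF assms(1)] leadsD(1)[OF assms(2)] p by (meson antisym)+
  with \<open>u \<noteq> v\<close> show False by simp
qed

text \<open>Equal counts after \<open>w\<close> reset the difference to 0, so \<open>w'\<close> is
  tested afresh.\<close>

lemma leads_append:
  assumes "count_list w u = count_list w v"
  shows "leads (w @ w') u v \<longleftrightarrow> leads w u v \<and> leads w' u v"
proof -
  have "(\<forall>p. prefix p (w @ w') \<longrightarrow> Q p) \<longleftrightarrow>
      (\<forall>p. prefix p w \<longrightarrow> Q p) \<and> (\<forall>p. prefix p w' \<longrightarrow> Q (w @ p))" for Q :: "'a list \<Rightarrow> bool"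
    by (auto simp: prefix_append)
  then show ?thesis using assms by (simp add: leads_def)
qed

text \<open>Only this inequality composes along a path; the slack 1 in the other one would
  accumulate.\<close>

lemma count_list_le_rtrancl:
  assumes "\<And>a b. (a, b) \<in> R \<Longrightarrow> leads w a b" "(u, v) \<in> R\<^sup>*" "prefix p w"
  shows "count_list p v \<le> count_list p u"
  using assms(2)
proof induction
  case (step y z)
  from leadsD(1)[OF assms(1)[OF step.hyps(2)] assms(3)] step.IH show ?case by (rule order_trans)
qed simp

section \<open>Orientations of a relation\<close>

definition represents :: "'a list \<Rightarrow> 'a set \<Rightarrow> 'a rel \<Rightarrow> bool" where
  "represents w V E \<longleftrightarrow> set w \<subseteq> V \<and>
     (\<forall>i \<in> V. \<forall>j \<in> V. i \<noteq> j \<longrightarrow> ((i, j) \<in> E \<longleftrightarrow> alternate w i j))"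

definition orients :: "'a rel \<Rightarrow> 'a rel \<Rightarrow> bool" where
  "orients R E \<longleftrightarrow> R \<union> R\<inverse> = E \<and> R \<inter> R\<inverse> = {}"

text \<open>Semi-transitivity with closures in place of explicit paths: the arc from
  \<open>a\<close> to \<open>b\<close> bypasses a walk through \<open>u\<close> and
  \<open>v\<close>. In an acyclic digraph such a walk is a path.\<close>

definition shortcut_free :: "'a rel \<Rightarrow> bool" where
  "shortcut_free R \<longleftrightarrow> (\<forall>a u v b. (a, b) \<in> R \<longrightarrow> (a, u) \<in> R\<^sup>* \<longrightarrow> (u, v) \<in> R\<^sup>+ \<longrightarrow>
     (v, b) \<in> R\<^sup>* \<longrightarrow> (u, v) \<in> R)"

lemma trans_orients_imp_acyclic:
  assumes "orients R E" "trans R"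
  shows "acyclic R"
  using assms unfolding orients_def acyclic_def by (auto simp: trancl_id)

lemma trans_imp_shortcut_free: "trans R \<Longrightarrow> shortcut_free R"
  unfolding shortcut_free_def by (auto simp: trancl_id)

text \<open>Once every letter occurs, \<open>leads_antisym\<close> makes leading select exactly one
  direction of each edge.\<close>

lemma represents_using_all_letters:
  assumes "finite V" "represents w V E"
  obtains w' where "represents w' V E" "set w' = V"
proof -
  have "\<exists>w'. represents w' V E \<and> set w' = V"
    using assms(2)
  proof (induction "card (V - set w)" arbitrary: w)
    case 0
    then have "set w = V"
      using assms(1) by (auto simp: represents_def)
    then show ?case using 0 by blast
  next
    case (Suc n)
    then obtain a where a: "a \<in> V - set w"
      by (metis card.empty equals0I nat.distinct(1))
    \<comment> \<open>With \<open>i\<close> absent, \<open>leads w i j\<close> forces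
      \<open>j\<close> to be absent too. Alternation of \<open>i\<close> and \<open>j\<close> thus
      reduces to \<open>leads w j i\<close>, which is also what prepending \<open>i\<close>
      tests.\<close>
    have leads_absent: "leads w j i" if "leads w i j" "i \<notin> set w" for i j
      unfolding leads_def
    proof (intro allI impI)
      fix p assume p: "prefix p w"
      then have "count_list p i = 0"
        using that(2) set_mono_prefix by (fastforce simp: count_list_0_iff)
      with leadsD[OF that(1) p] show "count_list p i \<le> count_list p j \<and>
          count_list p j \<le> count_list p i + 1" by simp
    qed
    have "alternate (a # w) i j \<longleftrightarrow> alternate w i j" if "i \<noteq> j" for i j
      using that leads_absent[of i j] leads_absent[of j i] a
      by (auto simp: alternate_iff_leads leads_Cons)
    then have "represents (a # w) V E"
      using Suc.prems a by (auto simp: represents_def)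
    moreover have "V - set (a # w) = (V - set w) - {a}" by auto
    then have "n = card (V - set (a # w))"
      using Suc.hyps(2) a assms(1) by (simp add: card_Diff_singleton)
    ultimately show ?case using Suc.hyps(1) by blast
  qed
  then show ?thesis using that by blast
qed

lemma represents_imp_leads:
  assumes "represents w V E" "(u, v) \<in> E" "u \<in> V" "v \<in> V" "u \<noteq> v"
  shows "leads w u v \<or> leads w v u"
  using assms by (auto simp: represents_def alternate_iff_leads)

lemma leads_imp_edge:
  assumes "represents w V E" "leads w u v" "u \<in> V" "v \<in> V" "u \<noteq> v"
  shows "(u, v) \<in> E"
  using assms by (auto simp: represents_def alternate_iff_leads)

section \<open>Words from shortcut-free orientations and back\<close>

lemma represents_imp_shortcut_free:
  assumes "finite V" "E \<subseteq> V \<times> V" "sym E" "irrefl E" "represents w V E"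
  shows "\<exists>R. orients R E \<and> acyclic R \<and> shortcut_free R"
proof -
  obtain w where rep: "represents w V E" and w: "set w = V"
    using represents_using_all_letters[OF assms(1,5)] .
  define R where "R = {(u, v). (u, v) \<in> E \<and> leads w u v}"
  have R_leads: "leads w a b" if "(a, b) \<in> R" for a b
    using that by (simp add: R_def)
  have R_sub: "a \<in> V" "b \<in> V" "a \<noteq> b" if "(a, b) \<in> R" for a b
    using that assms(2,4) by (auto simp: R_def irrefl_def)
  have anti: "(b, a) \<notin> R" if "(a, b) \<in> R" for a b
    using leads_antisym[of w a b] R_leads R_sub w that by blast
  have mono: "count_list p v \<le> count_list p u" if "(u, v) \<in> R\<^sup>*" "prefix p w" for u v p
    using count_list_le_rtrancl[of R w] R_leads that by blast
  have "orients R E"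
    unfolding orients_def
  proof
    have "(u, v) \<in> R \<or> (v, u) \<in> R" if "(u, v) \<in> E" for u v
      using represents_imp_leads[OF rep that] that assms(2-4)
      by (auto simp: R_def irrefl_def dest: symD)
    then show "R \<union> R\<inverse> = E" using assms(3) by (auto simp: R_def dest: symD)
    show "R \<inter> R\<inverse> = {}" using anti by auto
  qed
  moreover have acyclic: "acyclic R"
  proof (rule acyclicI, intro allI notI)
    fix a assume "(a, a) \<in> R\<^sup>+"
    then obtain b where b: "(a, b) \<in> R" "(b, a) \<in> R\<^sup>*" by (meson tranclD)
    \<comment> \<open>The path from \<open>b\<close> to \<open>a\<close> and the arc back bound the
      counts from both sides, so they are equal in every prefix.\<close>
    have "leads w b a"
      unfolding leads_def using mono[OF b(2)] leadsD[OF R_leads[OF b(1)]]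
      by (meson le_Suc_eq le_add1 order_trans)
    with leads_antisym[OF R_leads[OF b(1)]] R_sub[OF b(1)] w show False by blast
  qed
  moreover have "shortcut_free R"
    unfolding shortcut_free_def
  proof (intro allI impI)
    fix a u v b
    assume ab: "(a, b) \<in> R" and p: "(a, u) \<in> R\<^sup>*" "(u, v) \<in> R\<^sup>+" "(v, b) \<in> R\<^sup>*"
    have "leads w u v"
      unfolding leads_def
    proof (intro allI impI)
      fix p assume "prefix p w"
      with mono[OF p(1)] mono[OF trancl_into_rtrancl[OF p(2)]] mono[OF p(3)]
        leadsD(2)[OF R_leads[OF ab]]
      show "count_list p v \<le> count_list p u \<and> count_list p u \<le> count_list p v + 1"
        by fastforce
    qed
    moreover have "u \<noteq> v" using acyclic p(2) by (auto simp: acyclic_def)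
    moreover have "u \<in> V" "v \<in> V"
      using p(2) R_sub by (meson tranclD tranclD2)+
    ultimately show "(u, v) \<in> R"
      using leads_imp_edge[OF rep] by (simp add: R_def)
  qed
  ultimately show ?thesis by blast
qed

section \<open>Linear orders of letter occurrences\<close>

lemma topological_sort:
  assumes "finite A" "acyclic r"
  obtains xs where "set xs = A" "distinct xs" "sorted_wrt (\<lambda>x y. (y, x) \<notin> r) xs"
proof -
  have "\<exists>xs. set xs = A \<and> distinct xs \<and> sorted_wrt (\<lambda>x y. (y, x) \<notin> r) xs"
    using assms(1)
  proof (induction A rule: finite_psubset_induct)
    case (psubset A)
    show ?case
    proof (cases "A = {}")
      case False
      have "acyclic (Restr r A)" using assms(2) by (meson acyclic_subset inf_le1)
      moreover have "finite (Restr r A)" using psubset.hyps by simp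
      ultimately have "wf (Restr r A)" using finite_acyclic_wf by blast
      with False obtain m where m: "m \<in> A" "\<And>y. (y, m) \<in> Restr r A \<Longrightarrow> y \<notin> A"
        by (meson wfE_min ex_in_conv)
      from psubset.IH[of "A - {m}"] m(1) obtain xs where
        xs: "set xs = A - {m}" "distinct xs" "sorted_wrt (\<lambda>x y. (y, x) \<notin> r) xs"
        by blast
      have "set (m # xs) = A" "distinct (m # xs)" using m(1) xs(1,2) by auto
      moreover have "\<forall>y \<in> set xs. (y, m) \<notin> r" using m xs(1) by blast
      then have "sorted_wrt (\<lambda>x y. (y, x) \<notin> r) (m # xs)" using xs(3) by simp
      ultimately show ?thesis by blast
    qed auto
  qed
  then show ?thesis using that by blast
qed

text \<open>Prefixes are downward closed, which turns constraints on the order of occurrences into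
  inequalities of prefix counts.\<close>

lemma prefix_topological_sort:
  assumes "sorted_wrt (\<lambda>x y. (y, x) \<notin> r) xs" "prefix ys xs" "(x, y) \<in> r" "x \<in> set xs" "y \<in> set ys"
  shows "x \<in> set ys"
  using assms by (auto simp: prefix_def sorted_wrt_append)

text \<open>In a word in which every letter occurs twice, \<open>(a, False)\<close> and \<open>(a, True)\<close> stand for the first
  and the second occurrence of \<open>a\<close>. Then \<open>a\<close> leads \<open>b\<close> iff the occurrences come in the
  order \<open>a b a b\<close>.\<close>
definition occurrence_order :: "'a rel \<Rightarrow> ('a \<times> bool) rel" where
  "occurrence_order R =
     {((a, s), (b, s)) | a b s. (a, b) \<in> R} \<union> {((b, False), (a, True)) | a b. (a, b) \<in> R\<^sup>=}"

text \<open>No arc lowers the flag, so a walk changes it at most once, by an arc from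
  \<open>(b, False)\<close> to \<open>(a, True)\<close>; before and after that it follows
  \<open>R\<close>.\<close>

lemma occurrence_order_rtrancl:
  assumes "(x, y) \<in> (occurrence_order R)\<^sup>*"
  shows "snd x = snd y \<and> (fst x, fst y) \<in> R\<^sup>* \<or>
    \<not> snd x \<and> snd y \<and> (\<exists>a b. (fst x, b) \<in> R\<^sup>* \<and> (a, b) \<in> R\<^sup>= \<and> (a, fst y) \<in> R\<^sup>*)"
  using assms
proof induction
  case base
  then show ?case by simp
next
  case (step y z)
  consider a b s where "y = (a, s)" "z = (b, s)" "(a, b) \<in> R"
    | a b where "y = (b, False)" "z = (a, True)" "(a, b) \<in> R\<^sup>="
    using step.hyps(2) unfolding occurrence_order_def by blast
  then show ?case
  proof cases
    case 1
    have "(c, b) \<in> R\<^sup>*" if "(c, a) \<in> R\<^sup>*" for c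
      using that 1(3) by (rule rtrancl_into_rtrancl)
    then show ?thesis using step.IH unfolding 1(1,2) fst_conv snd_conv by blast
  next
    case 2
    then show ?thesis using step.IH unfolding 2(1,2) fst_conv snd_conv by blast
  qed
qed

text \<open>The flag is constant on a cycle, which therefore projects to a cycle of
  \<open>R\<close>.\<close>

lemma acyclic_occurrence_order:
  assumes "acyclic R"
  shows "acyclic (occurrence_order R)"
proof (rule acyclicI, intro allI notI)
  fix x assume "(x, x) \<in> (occurrence_order R)\<^sup>+"
  then obtain y where xy: "(x, y) \<in> occurrence_order R" and "(y, x) \<in> (occurrence_order R)\<^sup>*"
    by (meson tranclD)
  then have "(fst x, fst y) \<in> R \<and> (fst y, fst x) \<in> R\<^sup>*"
    using occurrence_order_rtrancl[of y x R] by (auto simp: occurrence_order_def)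
  then have "(fst x, fst x) \<in> R\<^sup>+" by (meson rtrancl_into_trancl2)
  with assms show False by (simp add: acyclic_def)
qed

lemma count_list_map_fst:
  fixes q :: "('a \<times> bool) list"
  shows "distinct q \<Longrightarrow> count_list (map fst q) a =
    of_bool ((a, False) \<in> set q) + of_bool ((a, True) \<in> set q)"
proof (induction q)
  case (Cons x q)
  then show ?case by (cases x; cases "snd x") auto
qed simp

text \<open>Unless \<open>x\<close> has to precede \<open>y\<close>, adding \<open>(y, x)\<close> to the occurrence order keeps it acyclic;
  the prefix \<open>q\<close> ends just before \<open>x\<close>.\<close>
lemma word_from_occurrences:
  assumes "finite V" "R \<subseteq> V \<times> V" "acyclic R"
    and "(x, y) \<notin> (occurrence_order R)\<^sup>*" "fst x \<in> V" "fst y \<in> V"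
  obtains w q where "set w \<subseteq> V" "\<And>a. a \<in> V \<Longrightarrow> count_list w a = 2"
    "\<And>a b. (a, b) \<in> R \<Longrightarrow> leads w a b"
    "prefix (map fst q) w" "distinct q" "y \<in> set q" "x \<notin> set q"
    "\<And>a. (a, True) \<in> set q \<Longrightarrow> (a, False) \<in> set q"
proof -
  define r where "r = insert (y, x) (occurrence_order R)"
  have "acyclic r"
    using acyclic_occurrence_order[OF assms(3)] assms(4) by (simp add: r_def acyclic_insert)
  moreover have "finite (V \<times> (UNIV :: bool set))" using assms(1) by simp
  ultimately obtain l where l: "set l = V \<times> (UNIV :: bool set)" "distinct l"
      and sorted: "sorted_wrt (\<lambda>x y. (y, x) \<notin> r) l"
    using topological_sort by metis
  have closed: "e \<in> set q" if "prefix q l" "(e, f) \<in> r" "f \<in> set q" "fst e \<in> V" for e f q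
    using prefix_topological_sort[OF sorted that(1,2)] that(3,4) l(1)
    by (auto simp: mem_Times_iff)
  have in_V: "a \<in> V" if "prefix q l" "(a, s) \<in> set q" for q a s
    using set_mono_prefix[OF that(1)] that(2) l(1) by auto
  have closed2: "(a, False) \<in> set q" if "prefix q l" "(a, True) \<in> set q" for a q
    using closed[OF that(1) _ that(2)] in_V[OF that]
    by (auto simp: r_def occurrence_order_def)
  have leads: "leads (map fst l) a b" if ab: "(a, b) \<in> R" for a b
    unfolding leads_def
  proof (intro allI impI)
    fix p assume "prefix p (map fst l)"
    then obtain q where p: "p = map fst q" and q: "prefix q l"
      using prefix_map_rightE by blast
    have V: "a \<in> V" "b \<in> V" using ab assms(2) by auto
    \<comment> \<open>Fact \<open>1\<close> gives the lower bound. By fact \<open>2\<close> the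
      second \<open>a\<close> comes after the first \<open>b\<close>, so \<open>a\<close> is never
      two ahead.\<close>
    have 1: "(a, s) \<in> set q" if "(b, s) \<in> set q" for s
      using closed[OF q _ that, of "(a, s)"] V ab by (auto simp: r_def occurrence_order_def)
    have 2: "(b, False) \<in> set q" if "(a, True) \<in> set q"
      using closed[OF q _ that, of "(b, False)"] V ab by (auto simp: r_def occurrence_order_def)
    have "distinct q" using q l(2) by (auto simp: prefix_def)
    then show "count_list p b \<le> count_list p a \<and> count_list p a \<le> count_list p b + 1"
      using 1 2 closed2[OF q] by (auto simp: p count_list_map_fst)
  qed
  have "x \<in> set l" using assms(5) l(1) by (cases x) auto
  then obtain q zs where q: "l = q @ x # zs" by (meson split_list)
  have pre: "prefix q l" "prefix (q @ [x]) l" using q by auto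
  have "x \<notin> set q" "distinct q" using l(2) q by auto
  have "x \<noteq> y" using assms(4) by auto
  \<comment> \<open>The added pair \<open>(y, x)\<close> puts \<open>y\<close> into the prefix
    \<open>q @ [x]\<close>, and \<open>y\<close> is not its last element.\<close>
  then have "y \<in> set q"
    using closed[OF pre(2), of y x] assms(6) by (auto simp: r_def)
  show thesis
  proof (rule that)
    show "set (map fst l) \<subseteq> V" using l(1) by auto
    show "count_list (map fst l) a = 2" if "a \<in> V" for a
      using that l by (simp add: count_list_map_fst)
    show "prefix (map fst q) (map fst l)" using pre(1) by (rule map_mono_prefix)
    show "leads (map fst l) a b" if "(a, b) \<in> R" for a b using that by (rule leads)
    show "(a, False) \<in> set q" if "(a, True) \<in> set q" for a using pre(1) that by (rule closed2)
  qed fact+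
qed

text \<open>The violating prefix contains \<open>u\<close> twice and no \<open>v\<close> if
  \<open>v\<close> is reachable from \<open>u\<close>; otherwise it contains \<open>v\<close> but no
  \<open>u\<close>.\<close>

lemma word_separating_pair:
  assumes "finite V" "R \<subseteq> V \<times> V" "acyclic R" "shortcut_free R"
    and "u \<in> V" "v \<in> V" "u \<noteq> v" "(u, v) \<notin> R"
  obtains w where "set w \<subseteq> V" "\<And>a. a \<in> V \<Longrightarrow> count_list w a = 2"
    "\<And>a b. (a, b) \<in> R \<Longrightarrow> leads w a b" "\<not> leads w u v"
proof (cases "(u, v) \<in> R\<^sup>*")
  case True
  then have uv: "(u, v) \<in> R\<^sup>+" using assms(7) by (meson rtranclD)
  \<comment> \<open>Otherwise some \<open>a\<close>, \<open>b\<close> satisfy: \<open>a\<close>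
    reaches \<open>u\<close>, \<open>v\<close> reaches \<open>b\<close>, and \<open>a = b\<close> or
    \<open>a\<close> to \<open>b\<close> is an arc. Equality closes a cycle through \<open>u\<close>
    and \<open>v\<close>; the arc is a shortcut that forces \<open>(u, v)\<close> into
    \<open>R\<close>.\<close>
  have *: "((v, False), (u, True)) \<notin> (occurrence_order R)\<^sup>*"
  proof
    assume "((v, False), (u, True)) \<in> (occurrence_order R)\<^sup>*"
    then obtain a b where ab: "(v, b) \<in> R\<^sup>*" "(a, b) \<in> R\<^sup>=" "(a, u) \<in> R\<^sup>*"
      using occurrence_order_rtrancl[of "(v, False)" "(u, True)" R]
      unfolding fst_conv snd_conv by blast
    show False
    proof (cases "a = b")
      case True
      with ab have "(v, u) \<in> R\<^sup>*" by (meson rtrancl_trans)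
      with uv have "(u, u) \<in> R\<^sup>+" by (rule trancl_rtrancl_trancl)
      with assms(3) show False by (simp add: acyclic_def)
    next
      case False
      with ab uv assms(4,8) show False unfolding shortcut_free_def by blast
    qed
  qed
  show ?thesis
  proof (rule word_from_occurrences[OF assms(1-3) *])
    show "fst (v, False) \<in> V" "fst (u, True) \<in> V" using assms(5,6) by simp_all
    fix w q
    assume w: "set w \<subseteq> V" "\<And>a. a \<in> V \<Longrightarrow> count_list w a = 2"
        "\<And>a b. (a, b) \<in> R \<Longrightarrow> leads w a b"
      and q: "prefix (map fst q) w" "distinct q" "(u, True) \<in> set q" "(v, False) \<notin> set q"
        "\<And>a. (a, True) \<in> set q \<Longrightarrow> (a, False) \<in> set q"
    have "count_list (map fst q) u = 2" "count_list (map fst q) v = 0"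
      using q(2-4) q(5)[of u] q(5)[of v] by (auto simp: count_list_map_fst)
    then have "\<not> leads w u v" using leadsD(2)[OF _ q(1), of u v] by auto
    with w show thesis by (rule that)
  qed
next
  case False
  then have *: "((u, False), (v, False)) \<notin> (occurrence_order R)\<^sup>*"
    using occurrence_order_rtrancl[of "(u, False)" "(v, False)" R] by auto
  show ?thesis
  proof (rule word_from_occurrences[OF assms(1-3) *])
    show "fst (u, False) \<in> V" "fst (v, False) \<in> V" using assms(5,6) by simp_all
    fix w q
    assume w: "set w \<subseteq> V" "\<And>a. a \<in> V \<Longrightarrow> count_list w a = 2"
        "\<And>a b. (a, b) \<in> R \<Longrightarrow> leads w a b"
      and q: "prefix (map fst q) w" "distinct q" "(v, False) \<in> set q" "(u, False) \<notin> set q"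
        "\<And>a. (a, True) \<in> set q \<Longrightarrow> (a, False) \<in> set q"
    have "count_list (map fst q) u = 0" "count_list (map fst q) v \<ge> 1"
      using q(2-4) q(5)[of u] q(5)[of v] by (auto simp: count_list_map_fst)
    then have "\<not> leads w u v" using leadsD(1)[OF _ q(1), of u v] by auto
    with w show thesis by (rule that)
  qed
qed

lemma shortcut_free_imp_represents:
  assumes "finite V" "E \<subseteq> V \<times> V" "orients R E" "acyclic R" "shortcut_free R"
  shows "\<exists>w. represents w V E"
proof -
  have R: "R \<subseteq> V \<times> V" using assms(2,3) by (auto simp: orients_def)
  \<comment> \<open>The common number \<open>k\<close> of occurrences is carried along so that
    \<open>leads_append\<close> applies when the word for the next pair is appended.\<close>
  have sep: "\<exists>w k. set w \<subseteq> V \<and> (\<forall>a \<in> V. count_list w a = k) \<and>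
      (\<forall>a b. (a, b) \<in> R \<longrightarrow> leads w a b) \<and> (\<forall>u v. (u, v) \<in> P \<longrightarrow> \<not> leads w u v)"
    if "finite P" "\<And>u v. (u, v) \<in> P \<Longrightarrow> u \<in> V \<and> v \<in> V \<and> u \<noteq> v \<and> (u, v) \<notin> R" for P
    using that
  proof (induction P)
    case empty
    show ?case by (rule exI[of _ "[]"]) auto
  next
    case (insert e P)
    have "\<exists>w k. set w \<subseteq> V \<and> (\<forall>a \<in> V. count_list w a = k) \<and>
        (\<forall>a b. (a, b) \<in> R \<longrightarrow> leads w a b) \<and> (\<forall>u v. (u, v) \<in> P \<longrightarrow> \<not> leads w u v)"
      by (rule insert.IH) (rule insert.prems, simp)
    then obtain w k where w: "set w \<subseteq> V" "\<And>a. a \<in> V \<Longrightarrow> count_list w a = k"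
        "\<And>a b. (a, b) \<in> R \<Longrightarrow> leads w a b" "\<And>u v. (u, v) \<in> P \<Longrightarrow> \<not> leads w u v"
      by blast
    obtain u v where e: "e = (u, v)" by fastforce
    have uv: "u \<in> V" "v \<in> V" "u \<noteq> v" "(u, v) \<notin> R" using insert.prems[of u v] e by simp_all
    obtain w' where w': "set w' \<subseteq> V" "\<And>a. a \<in> V \<Longrightarrow> count_list w' a = 2"
        "\<And>a b. (a, b) \<in> R \<Longrightarrow> leads w' a b" "\<not> leads w' u v"
      using word_separating_pair[OF assms(1) R assms(4,5) uv] by blast
    have app: "leads (w @ w') a b \<longleftrightarrow> leads w a b \<and> leads w' a b" if "a \<in> V" "b \<in> V" for a b
      using that w(2) by (simp add: leads_append)
    show ?case
    proof (intro exI conjI allI impI ballI)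
      show "set (w @ w') \<subseteq> V" using w w' by simp
      show "count_list (w @ w') a = k + 2" if "a \<in> V" for a using w(2) w'(2) that by simp
      show "leads (w @ w') a b" if "(a, b) \<in> R" for a b
        using app[of a b] w(3)[OF that] w'(3)[OF that] R that by auto
      show "\<not> leads (w @ w') a b" if "(a, b) \<in> insert e P" for a b
        using app[of a b] w(4)[of a b] w'(4) e insert.prems[OF that] that by auto
    qed
  qed
  \<comment> \<open>Since \<open>E\<close> is symmetric, \<open>?P\<close> holds both orders of each
    non-adjacent pair, so neither letter leads the other.\<close>
  let ?P = "{(u, v) \<in> V \<times> V. u \<noteq> v \<and> (u, v) \<notin> E}"
  have "finite ?P" by (rule finite_subset[of _ "V \<times> V"]) (use assms(1) in auto)
  then have "\<exists>w k. set w \<subseteq> V \<and> (\<forall>a \<in> V. count_list w a = k) \<and>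
      (\<forall>a b. (a, b) \<in> R \<longrightarrow> leads w a b) \<and> (\<forall>u v. (u, v) \<in> ?P \<longrightarrow> \<not> leads w u v)"
    using assms(3) by (intro sep) (auto simp: orients_def)
  then obtain w where w: "set w \<subseteq> V" "\<And>a b. (a, b) \<in> R \<Longrightarrow> leads w a b"
      "\<And>u v. (u, v) \<in> ?P \<Longrightarrow> \<not> leads w u v"
    by blast
  have "represents w V E"
    unfolding represents_def
  proof (intro conjI ballI impI w(1))
    fix i j assume ij: "i \<in> V" "j \<in> V" "i \<noteq> j"
    have "(i, j) \<in> E \<longleftrightarrow> (i, j) \<in> R \<or> (j, i) \<in> R" "(j, i) \<in> E \<longleftrightarrow> (i, j) \<in> R \<or> (j, i) \<in> R"
      using assms(3) by (auto simp: orients_def)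
    then show "(i, j) \<in> E \<longleftrightarrow> alternate w i j"
      using ij w(2,3) by (auto simp: alternate_iff_leads)
  qed
  then show ?thesis by blast
qed

section \<open>Adding a vertex adjacent to all others\<close>

text \<open>Letters occurring before \<open>x\<close> have to be moved behind the others, as if the word were
  rotated to start with \<open>x\<close>: hence the second disjunct in the definition of \<open>R\<close>.\<close>
lemma represents_apex_imp_trans:
  assumes "finite V" "x \<notin> V" "sym E" "irrefl E" "\<And>v. v \<in> V \<Longrightarrow> (x, v) \<in> E"
    and "represents w (insert x V) E"
  shows "\<exists>R. orients R (Restr E V) \<and> trans R"
proof -
  obtain w where rep: "represents w (insert x V) E" and w: "set w = insert x V"
    using represents_using_all_letters[OF _ assms(6)] assms(1) by blast
  have x: "leads w x u \<or> leads w u x" "\<not> (leads w x u \<and> leads w u x)" if "u \<in> V" for u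
    using represents_imp_leads[OF rep assms(5)] leads_antisym[of w x u] that assms(2) w by auto
  have edge: "leads w u v \<or> leads w v u" "u \<noteq> v" "u \<in> V" "v \<in> V" if "(u, v) \<in> Restr E V" for u v
    using represents_imp_leads[OF rep] that assms(4) by (auto simp: irrefl_def)
  have anti: "\<not> (leads w u v \<and> leads w v u)" if "u \<in> V" "u \<noteq> v" for u v
    using leads_antisym[of w u v] that w by auto
  define R where "R = {(u, v) \<in> Restr E V.
    (leads w x u \<longleftrightarrow> leads w x v) \<and> leads w u v \<or> leads w x u \<and> leads w v x}"
  \<comment> \<open>If \<open>u\<close> led \<open>v\<close>, the counts would satisfy
    \<open>x >= u >= v >= x\<close> in every prefix, so \<open>x\<close> and \<open>v\<close> would
    lead each other.\<close>
  have leads_across: "leads w v u" if "(u, v) \<in> Restr E V" "leads w x u" "leads w v x" for u v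
  proof (rule ccontr)
    assume "\<not> leads w v u"
    then have "leads w u v" using edge that(1) by blast
    then have "leads w x v"
      unfolding leads_def
    proof (intro allI impI)
      fix p assume p: "prefix p w"
      show "count_list p v \<le> count_list p x \<and> count_list p x \<le> count_list p v + 1"
        using leadsD[OF \<open>leads w u v\<close> p] leadsD[OF that(2) p] leadsD[OF that(3) p] by simp
    qed
    with x(2) that edge show False by blast
  qed
  \<comment> \<open>Leading in either direction already yields the edge, so transitivity below
    reduces to prefix inequalities.\<close>
  have RI: "(u, v) \<in> R" if "u \<in> V" "v \<in> V" "u \<noteq> v"
    "(leads w x u \<longleftrightarrow> leads w x v) \<and> leads w u v \<or> leads w x u \<and> leads w v x \<and> leads w v u" for u v
  proof -
    have "(u, v) \<in> E" "(v, u) \<in> E"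
      using leads_imp_edge[OF rep, of u v] leads_imp_edge[OF rep, of v u] that assms(3)
      by (auto dest: symD)
    then show ?thesis using that by (auto simp: R_def)
  qed
  have "orients R (Restr E V)"
    unfolding orients_def
  proof
    have "(u, v) \<in> R \<or> (v, u) \<in> R" if "(u, v) \<in> Restr E V" for u v
    proof -
      have "(v, u) \<in> Restr E V" using that assms(3) by (auto dest: symD)
      then show ?thesis using that edge[OF that] x[of u] x[of v] unfolding R_def by blast
    qed
    moreover have "R \<subseteq> Restr E V" by (auto simp: R_def)
    ultimately show "R \<union> R\<inverse> = Restr E V" using assms(3) by (auto dest: symD)
    have False if "(u, v) \<in> R" "(v, u) \<in> R" for u v
    proof -
      have "(u, v) \<in> Restr E V" using that by (auto simp: R_def)
      with that show False
        using edge[of u v] x[of u] x[of v] anti[of u v] unfolding R_def by blast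
    qed
    then show "R \<inter> R\<inverse> = {}" by auto
  qed
  moreover have "trans R"
  proof (rule transI)
    fix a b c assume ab: "(a, b) \<in> R" and bc: "(b, c) \<in> R"
    have E: "(a, b) \<in> Restr E V" "(b, c) \<in> Restr E V" using ab bc by (auto simp: R_def)
    then have V: "a \<in> V" "b \<in> V" "c \<in> V" by auto
    have "a \<noteq> c"
      using ab bc \<open>orients R (Restr E V)\<close> by (auto simp: orients_def)
    \<comment> \<open>Arcs of \<open>R\<close> may pass from letters led by \<open>x\<close> to
      letters leading \<open>x\<close>, but never back, so at most one switch occurs. Without a
      switch, \<open>b\<close> gives the lower inequality and \<open>x\<close> the upper; with one,
      \<open>x\<close> gives the lower and \<open>b\<close> the upper.\<close>
    consider "leads w x a" "leads w x b" "leads w x c" "leads w a b" "leads w b c"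
      | "leads w a x" "leads w b x" "leads w c x" "leads w a b" "leads w b c"
      | "leads w x a" "leads w x b" "leads w c x" "leads w a b" "leads w c b"
      | "leads w x a" "leads w b x" "leads w c x" "leads w b a" "leads w b c"
      using ab bc x[OF V(1)] x[OF V(2)] x[OF V(3)] leads_across[OF E(1)] leads_across[OF E(2)]
      unfolding R_def by blast
    then show "(a, c) \<in> R"
    proof cases
      case 1
      have "leads w a c"
        unfolding leads_def
      proof (intro allI impI)
        fix p assume "prefix p w"
        with 1[THEN leadsD(1)] 1[THEN leadsD(2)]
        show "count_list p c \<le> count_list p a \<and> count_list p a \<le> count_list p c + 1" by fastforce
      qed
      with 1 RI V \<open>a \<noteq> c\<close> show ?thesis by blast
    next
      case 2
      have "leads w a c"
        unfolding leads_def
      proof (intro allI impI)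
        fix p assume "prefix p w"
        with 2[THEN leadsD(1)] 2[THEN leadsD(2)]
        show "count_list p c \<le> count_list p a \<and> count_list p a \<le> count_list p c + 1" by fastforce
      qed
      with 2 RI V x \<open>a \<noteq> c\<close> show ?thesis by blast
    next
      case 3
      have "leads w c a"
        unfolding leads_def
      proof (intro allI impI)
        fix p assume "prefix p w"
        with 3[THEN leadsD(1)] 3[THEN leadsD(2)]
        show "count_list p a \<le> count_list p c \<and> count_list p c \<le> count_list p a + 1" by fastforce
      qed
      with 3 RI V \<open>a \<noteq> c\<close> show ?thesis by blast
    next
      case 4
      have "leads w c a"
        unfolding leads_def
      proof (intro allI impI)
        fix p assume "prefix p w"
        with 4[THEN leadsD(1)] 4[THEN leadsD(2)]
        show "count_list p a \<le> count_list p c \<and> count_list p c \<le> count_list p a + 1" by fastforce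
      qed
      with 4 RI V \<open>a \<noteq> c\<close> show ?thesis by blast
    qed
  qed
  ultimately show ?thesis by blast
qed

lemma represents_cong: "represents w V (Restr E V) \<longleftrightarrow> represents w V E"
  by (auto simp: represents_def)

text \<open>Nothing enters the new source \<open>x\<close>, so the extended orientation stays
  transitive, hence acyclic and shortcut-free.\<close>

lemma trans_imp_represents_apex:
  assumes "finite V" "x \<notin> V" "sym E" "irrefl E" "\<And>v. v \<in> V \<Longrightarrow> (x, v) \<in> E"
    and "orients R (Restr E V)" "trans R"
  shows "\<exists>w. represents w (insert x V) E"
proof -
  let ?R = "R \<union> {x} \<times> V"
  have R: "R \<subseteq> V \<times> V" using assms(6) by (auto simp: orients_def)
  have "(v, x) \<in> E" if "v \<in> V" for v using that assms(3,5) by (auto dest: symD)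
  moreover have "(x, x) \<notin> E" using assms(4) by (simp add: irrefl_def)
  ultimately have "Restr E (insert x V) = Restr E V \<union> {x} \<times> V \<union> V \<times> {x}"
    using assms(5) by auto
  then have o: "orients ?R (Restr E (insert x V))"
    using assms(2,6) R unfolding orients_def by blast
  have t: "trans ?R" using assms(2,7) R unfolding trans_def by blast
  have "\<exists>w. represents w (insert x V) (Restr E (insert x V))"
    using o trans_orients_imp_acyclic[OF o t] trans_imp_shortcut_free[OF t] assms(1)
    by (intro shortcut_free_imp_represents) auto
  then show ?thesis by (simp only: represents_cong)
qed

section \<open>Graphs\<close>

lemma vwalk_nth_trancl:
  "vwalk p D \<Longrightarrow> i < j \<Longrightarrow> j < length p \<Longrightarrow> (p ! i, p ! j) \<in> (arcs_ends D)\<^sup>+"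
proof (induction p arbitrary: i j rule: vwalk_induct)
  case (Cons u v es)
  then obtain j' where j: "j = Suc j'" "j' < length (v # es)" by (cases j) auto
  show ?case
  proof (cases i)
    case 0
    then show ?thesis
      using Cons.IH[of 0 j'] Cons.hyps j by (cases j') (auto intro: trancl_into_trancl2)
  next
    case (Suc i')
    then show ?thesis using Cons.IH[of i' j'] Cons.prems j by simp
  qed
qed simp

text \<open>Extending a given walk, instead of just producing one, allows routing through prescribed
  vertices \<open>u\<close> and \<open>v\<close>.\<close>

lemma (in wf_digraph) vwalk_extend:
  assumes "vwalk p G" "(last p, v) \<in> (arcs_ends G)\<^sup>*"
  obtains q where "vwalk (p @ q) G" "last (p @ q) = v"
proof -
  have "\<exists>q. vwalk (p @ q) G \<and> last (p @ q) = v"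
    using assms(2)
  proof induction
    case base
    then show ?case using assms(1) by (intro exI[of _ "[]"]) simp
  next
    case (step y z)
    then obtain q where q: "vwalk (p @ q) G" "last (p @ q) = y" by blast
    moreover have "z \<in> verts G" using step.hyps(2) adj_in_verts by blast
    ultimately have "vwalk ((p @ q) @ [z]) G"
      using step.hyps(2) unfolding vwalk_def by (simp add: vwalk_arcs_append del: append_assoc)
    then show ?case by (intro exI[of _ "q @ [z]"]) simp
  qed
  then show ?thesis using that by blast
qed

lemma shortcut_free_iff_vpath:
  assumes "wf_digraph D" "acyclic (arcs_ends D)"
  shows "shortcut_free (arcs_ends D) \<longleftrightarrow> (\<forall>p. vpath p D \<longrightarrow>
    \<not> (hd p \<rightarrow>\<^bsub>D\<^esub> last p) \<or> (\<forall>i j. i < j \<and> j < length p \<longrightarrow> p ! i \<rightarrow>\<^bsub>D\<^esub> p ! j))"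
    (is "_ \<longleftrightarrow> (\<forall>p. ?Q p)")
proof
  assume sf: "shortcut_free (arcs_ends D)"
  show "\<forall>p. ?Q p"
  proof (unfold imp_conv_disj[symmetric], intro allI impI)
    fix p i j
    assume p: "vpath p D" and e: "hd p \<rightarrow>\<^bsub>D\<^esub> last p" and ij: "i < j \<and> j < length p"
    have w: "vwalk p D" using p by (simp add: vpath_def)
    then have "p \<noteq> []" by (simp add: vwalk_def)
    then have "hd p = p ! 0" "last p = p ! (length p - 1)"
      by (simp_all add: hd_conv_nth last_conv_nth)
    moreover have "(p ! 0, p ! i) \<in> (arcs_ends D)\<^sup>*"
      using vwalk_nth_trancl[OF w, of 0 i] ij by (cases "i = 0") auto
    moreover have "(p ! j, p ! (length p - 1)) \<in> (arcs_ends D)\<^sup>*"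
    proof (cases "j = length p - 1")
      case False
      with ij have "j < length p - 1" "length p - 1 < length p" by linarith+
      then show ?thesis by (intro trancl_into_rtrancl vwalk_nth_trancl[OF w])
    qed simp
    moreover have "(p ! i, p ! j) \<in> (arcs_ends D)\<^sup>+"
      using vwalk_nth_trancl[OF w] ij by blast
    ultimately show "p ! i \<rightarrow>\<^bsub>D\<^esub> p ! j" using sf e unfolding shortcut_free_def by metis
  qed
next
  interpret wf_digraph D by fact
  assume Q: "\<forall>p. ?Q p"
  show "shortcut_free (arcs_ends D)"
    unfolding shortcut_free_def
  proof (intro allI impI)
    fix a u v b
    assume ab: "(a, b) \<in> arcs_ends D" and au: "(a, u) \<in> (arcs_ends D)\<^sup>*"
      and uv: "(u, v) \<in> (arcs_ends D)\<^sup>+" and vb: "(v, b) \<in> (arcs_ends D)\<^sup>*"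
    have "vwalk [a] D" using ab adj_in_verts by (auto simp: vwalk_def)
    then obtain q1 where q1: "vwalk ([a] @ q1) D" "last ([a] @ q1) = u"
      using vwalk_extend[of "[a]" u] au by auto
    then obtain q2 where q2: "vwalk (([a] @ q1) @ q2) D" "last (([a] @ q1) @ q2) = v"
      using vwalk_extend[OF q1(1), of v] uv by (auto dest: trancl_into_rtrancl)
    then obtain q3 where q3: "vwalk ((([a] @ q1) @ q2) @ q3) D" "last ((([a] @ q1) @ q2) @ q3) = b"
      using vwalk_extend[OF q2(1), of b] vb by auto
    define p where "p = (([a] @ q1) @ q2) @ q3"
    \<comment> \<open>A repeated vertex would lie on a cycle.\<close>
    have "distinct p"
      unfolding distinct_conv_nth
      using vwalk_nth_trancl[OF q3(1)] assms(2) unfolding p_def acyclic_def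
      by (metis nat_neq_iff)
    then have "vpath p D" using q3(1) by (auto simp: vpath_def p_def)
    moreover have "hd p = a" "last p = b" using q3(2) by (auto simp: p_def)
    moreover have "u \<noteq> v" using uv assms(2) by (auto simp: acyclic_def)
    \<comment> \<open>This makes the index \<open>length q1\<close> of \<open>u\<close> strictly
      smaller than the index \<open>length q1 + length q2\<close> of \<open>v\<close>; the initial
      \<open>a\<close> has index 0.\<close>
    then have "q2 \<noteq> []" using q1(2) q2(2) by (metis append_Nil2)
    moreover have "p ! length q1 = u"
      using q1(2) by (cases q1 rule: rev_cases) (auto simp: p_def nth_append nth_Cons split: nat.split)
    moreover have "p ! (length q1 + length q2) = v"
      using q2(2) \<open>q2 \<noteq> []\<close>
      by (cases q2 rule: rev_cases) (auto simp: p_def nth_append nth_Cons split: nat.split)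
    moreover have "length q1 + length q2 < length p" by (simp add: p_def)
    ultimately show "(u, v) \<in> arcs_ends D"
      using Q ab by (metis length_greater_0_conv less_add_same_cancel1)
  qed
qed

section \<open>Graph notions in relational form\<close>

lemma arcs_ends_induce_subgraph: "arcs_ends (G \<restriction> S) = Restr (arcs_ends G) S"
  by (auto simp: arcs_ends_conv)

lemma word_representable_iff_represents:
  "word_representable G \<longleftrightarrow> (\<exists>w. represents w (verts G) (arcs_ends G))"
  by (simp add: word_representable_def represents_def)

text \<open>The arbitrary \<open>P\<close> lets one translation serve both comparability and
  semi-transitivity.\<close>

lemma orientation_iff_orients:
  assumes "graph G"
  shows "(\<exists>D. orientation D G \<and> P (arcs_ends D)) \<longleftrightarrow> (\<exists>R. orients R (arcs_ends G) \<and> P R)"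
proof
  interpret graph G by fact
  assume "\<exists>D. orientation D G \<and> P (arcs_ends D)"
  then obtain D where D: "orientation D G" "P (arcs_ends D)" by blast
  have "subgraph D G" using D(1) by (auto simp: orientation_def spanning_def)
  then have sub: "arcs_ends D \<subseteq> arcs_ends G"
    by (auto simp: subgraph_def compatible_def arcs_ends_conv)
  have "sym (arcs_ends G)" using sym_arcs by (simp add: symmetric_def)
  then have "orients (arcs_ends D) (arcs_ends G)"
    using D(1) sub unfolding orients_def orientation_def by (auto dest: symD)
  with D(2) show "\<exists>R. orients R (arcs_ends G) \<and> P R" by blast
next
  interpret graph G by fact
  assume "\<exists>R. orients R (arcs_ends G) \<and> P R"
  then obtain R where R: "orients R (arcs_ends G)" "P R" by blast
  \<comment> \<open>All vertices are kept, and only the arcs whose ends form a pair in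
    \<open>R\<close> survive.\<close>
  define D where "D = G \<lparr> arcs := {e \<in> arcs G. arc_to_ends G e \<in> R} \<rparr>"
  have "R \<subseteq> arcs_ends G" using R(1) by (auto simp: orients_def)
  then have ends: "arcs_ends D = R"
    by (fastforce simp: D_def arcs_ends_def arc_to_ends_def)
  have "wf_digraph D" by unfold_locales (auto simp: D_def)
  then have "spanning D G"
    unfolding spanning_def subgraph_def
    using wf_digraph_axioms by (auto simp: D_def compatible_def)
  then have "orientation D G"
    using R(1) ends unfolding orientation_def orients_def by auto
  with ends R(2) show "\<exists>D. orientation D G \<and> P (arcs_ends D)" by blast
qed

lemma comparability_graph_iff_orients:
  assumes "graph G"
  shows "comparability_graph G \<longleftrightarrow> (\<exists>R. orients R (arcs_ends G) \<and> trans R)"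
  unfolding comparability_graph_def orientation_iff_orients[OF assms] ..

lemma semi_transitive_iff_orients:
  assumes "graph G"
  shows "semi_transitive G \<longleftrightarrow> (\<exists>R. orients R (arcs_ends G) \<and> acyclic R \<and> shortcut_free R)"
proof -
  have "wf_digraph D" if "orientation D G" for D
    using that by (auto simp: orientation_def spanning_def subgraph_def)
  then have "semi_transitive G \<longleftrightarrow>
      (\<exists>D. orientation D G \<and> acyclic (arcs_ends D) \<and> shortcut_free (arcs_ends D))"
    unfolding semi_transitive_def using shortcut_free_iff_vpath by blast
  then show ?thesis
    using orientation_iff_orients[OF assms, of "\<lambda>R. acyclic R \<and> shortcut_free R"] by simp
qed

context graph
begin

lemma irrefl_arcs_ends: "irrefl (arcs_ends G)"
  using adj_not_same by (auto simp: irrefl_def)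

lemma sym_arcs_ends: "sym (arcs_ends G)"
  using sym_arcs by (simp add: symmetric_def)

lemma arcs_ends_subset: "arcs_ends G \<subseteq> verts G \<times> verts G"
  using adj_in_verts by auto

lemma graph_induce_subgraph:
  assumes "S \<subseteq> verts G"
  shows "graph (G \<restriction> S)"
proof -
  have sub: "induced_subgraph (G \<restriction> S) G" using assms by (rule induced_induce)
  show ?thesis
    by (rule digraph.graphI[OF digraphI_induced[OF sub]
          induced_graph_imp_symmetric[OF sym_arcs sub]])
qed

lemma semi_transitive_iff_word_representable: "semi_transitive G \<longleftrightarrow> word_representable G"
  unfolding semi_transitive_iff_orients[OF graph_axioms] word_representable_iff_represents
  using represents_imp_shortcut_free[OF finite_verts arcs_ends_subset sym_arcs_ends irrefl_arcs_ends]
    shortcut_free_imp_represents[OF finite_verts arcs_ends_subset]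
  by blast

text \<open>Without parallel arcs the heads of the arcs leaving \<open>x\<close> are distinct, and
  without loops none is \<open>x\<close>; by counting they exhaust the other vertices.\<close>

lemma apex_adjacent:
  assumes "x \<in> verts G" "out_degree G x = card (verts G) - 1" "v \<in> verts G - {x}"
  shows "x \<rightarrow>\<^bsub>G\<^esub> v"
proof -
  have "inj_on (head G) (out_arcs G x)"
    using no_multi_arcs by (auto simp: inj_on_def out_arcs_def arc_to_ends_def)
  then have "card (head G ` out_arcs G x) = card (verts G - {x})"
    using assms(1,2) by (simp add: card_image out_degree_def)
  moreover have "head G ` out_arcs G x \<subseteq> verts G - {x}"
    using no_loops by (fastforce simp: out_arcs_def)
  ultimately have "head G ` out_arcs G x = verts G - {x}"
    by (intro card_subset_eq) auto
  with assms(3) obtain e where "e \<in> out_arcs G x" "v = head G e" by blast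
  then show ?thesis by (intro dominatesI[where a = e]) (auto simp: out_arcs_def arc_to_ends_def)
qed

text \<open>Leaving \<open>S\<close> arbitrary covers both the whole graph and every induced
  subgraph containing the apex.\<close>

lemma word_representable_apex_iff_comparability:
  assumes "S \<subseteq> verts G" "x \<notin> S" "\<And>v. v \<in> S \<Longrightarrow> x \<rightarrow>\<^bsub>G\<^esub> v"
  shows "word_representable (G \<restriction> insert x S) \<longleftrightarrow> comparability_graph (G \<restriction> S)"
proof -
  have "finite S" using assms(1) finite_verts finite_subset by blast
  note * = this assms(2) sym_arcs_ends irrefl_arcs_ends assms(3)
  have "(\<exists>w. represents w (insert x S) (arcs_ends G)) \<longleftrightarrow>
      (\<exists>R. orients R (Restr (arcs_ends G) S) \<and> trans R)"
    using represents_apex_imp_trans[OF *] trans_imp_represents_apex[OF *] by blast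
  then show ?thesis
    unfolding comparability_graph_iff_orients[OF graph_induce_subgraph[OF assms(1)]]
      word_representable_iff_represents arcs_ends_induce_subgraph induce_subgraph_verts
      represents_cong .
qed

lemma comparability_imp_word_representable:
  assumes "comparability_graph G"
  shows "word_representable G"
  using assms trans_orients_imp_acyclic trans_imp_shortcut_free
  unfolding comparability_graph_iff_orients[OF graph_axioms]
    semi_transitive_iff_word_representable[symmetric] semi_transitive_iff_orients[OF graph_axioms]
  by blast

end

theorem theorem9:
  fixes G H :: "('a, 'b) pre_digraph" and n :: nat and x :: 'a
  assumes "graph G"
    and "card (verts G) = n"
    and "x \<in> verts G"
    and "out_degree G x = n - 1"
    and "H = G \<restriction> (verts G - {x})"
  shows "minimal_non_word_representable G \<longleftrightarrow>
    minimal_non_comparability_graph H \<and> semi_transitive H"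
proof -
  interpret graph G by fact
  let ?V = "verts G - {x}"
  have apex: "word_representable (G \<restriction> insert x S) \<longleftrightarrow> comparability_graph (G \<restriction> S)"
    if "S \<subseteq> ?V" for S
    using that assms(2-4) apex_adjacent
    by (intro word_representable_apex_iff_comparability) auto
  have "word_representable (G \<restriction> verts G) \<longleftrightarrow> word_representable G"
    using arcs_ends_subset
    by (simp add: word_representable_iff_represents arcs_ends_induce_subgraph represents_cong)
  with apex[of ?V] assms(3,5) have G: "word_representable G \<longleftrightarrow> comparability_graph H"
    by (simp add: insert_absorb)
  have H: "semi_transitive H \<longleftrightarrow> word_representable H"
    using graph.semi_transitive_iff_word_representable[OF graph_induce_subgraph[of ?V]] assms(5)
    by simp
  have HS: "H \<restriction> S = G \<restriction> S" if "S \<subseteq> ?V" for S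
    using that by (auto simp: assms(5) induce_subgraph_def)
  have vH: "verts H = ?V" by (simp add: assms(5))
  show ?thesis
  proof
    assume L: "minimal_non_word_representable G"
    then have "word_representable H"
      using assms(3,5) by (auto simp: minimal_non_word_representable_def)
    moreover have "\<not> comparability_graph H"
      using L G unfolding minimal_non_word_representable_def by blast
    moreover have "comparability_graph (H \<restriction> S)" if "S \<subset> ?V" for S
    proof -
      have "insert x S \<subset> verts G" using that assms(3) by auto
      then have "word_representable (G \<restriction> insert x S)"
        using L by (simp add: minimal_non_word_representable_def)
      then show ?thesis using apex[of S] HS[of S] that by simp
    qed
    ultimately show "minimal_non_comparability_graph H \<and> semi_transitive H"
      unfolding minimal_non_comparability_graph_def vH H by blast
  next
    assume R: "minimal_non_comparability_graph H \<and> semi_transitive H"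
    have comp: "comparability_graph (G \<restriction> S)" if "S \<subset> ?V" for S
    proof -
      have "comparability_graph (H \<restriction> S)"
        using R that unfolding minimal_non_comparability_graph_def vH by blast
      then show ?thesis using HS[of S] that by simp
    qed
    have "word_representable (G \<restriction> S)" if S: "S \<subset> verts G" for S
    proof (cases "x \<in> S")
      case True
      \<comment> \<open>The omitted \<open>y\<close> differs from \<open>x\<close>, so
        \<open>S - {x}\<close> is still proper in \<open>?V\<close>.\<close>
      from S obtain y where "y \<in> verts G" "y \<notin> S" by blast
      with S True have sub: "S - {x} \<subset> ?V" by blast
      then have "word_representable (G \<restriction> insert x (S - {x}))"
        using comp[OF sub] apex[of "S - {x}"] by blast
      then show ?thesis using True by (simp only: insert_Diff)
    next
      case False
      then have "S \<subseteq> ?V" using S by blast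
      show ?thesis
      \<comment> \<open>For \<open>S = ?V\<close> the subgraph is \<open>H\<close>, which is not a
        comparability graph; here its semi-transitivity supplies the word.\<close>
      proof (cases "S = ?V")
        case True
        then show ?thesis using R H assms(5) by simp
      next
        case False
        with \<open>S \<subseteq> ?V\<close> have "comparability_graph (G \<restriction> S)" by (intro comp) blast
        moreover have "graph (G \<restriction> S)" using S by (intro graph_induce_subgraph) blast
        ultimately show ?thesis by (intro graph.comparability_imp_word_representable)
      qed
    qed
    then show "minimal_non_word_representable G"
      using R G unfolding minimal_non_word_representable_def minimal_non_comparability_graph_def
      by blast
  qed
qed

end
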